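(* Let $\mathcal{P}$ be a non-trivial partial order, and let $\Pi\mathcal{P}=\prod_{i\in I}\mathcal{P}$ be an infinite direct power of $\mathcal{P}$ (that is, the index set $I$ is infinite). Then $\Pi\mathcal{P}$ is not $\mathcal{L}_p(\Pi\mathcal{P})$-equationally Noetherian.
   Context: The partial order language is $\mathcal{L}_p=\{\leq^{(2)}\}$, with one binary relation symbol. A partial order is an $\mathcal{L}_p$-structure in which $\leq$ is reflexive, antisymmetric and transitive. A partial order $\mathcal{P}$ is non-trivial if there exist $a,b\in\mathcal{P}$ with $a<b$ (i.e. $a\leq b$ and $a\neq b$). The direct power $\Pi\mathcal{A}=\prod_{i\in I}\mathcal{A}$ of a structure $\mathcal{A}$ consists of all families $[a_i\mid i\in I]$ with $a_i\in\mathcal{A}$; relations are defined coordinate-wise (a relation holds in $\Pi\mathcal{A}$ iff it holds in every coordinate $i\in I$). For an $\mathcal{L}$-structure $\mathcal{B}$, $\mathcal{L}(\mathcal{B})$ is the language $\mathcal{L}\cup\{b\mid b\in\mathcal{B}\}$ obtained by adding a constant symbol for every element of $\mathcal{B}$, interpreted by that element. An $\mathcal{L}(\mathcal{B})$-equation is an atomic formula of $\mathcal{L}(\mathcal{B})$ (equalities included). An $\mathcal{L}(\mathcal{B})$-system is an arbitrary set of $\mathcal{L}(\mathcal{B})$-equations in a finite set of variables $x_1,\dots,x_n$; its solution set over $\mathcal{B}$ is the set of points of $\mathcal{B}^n$ satisfying all its equations. Two systems in the same variables are equivalent over $\mathcal{B}$ if they have the same solution set. $\mathcal{B}$ is $\mathcal{L}(\mathcal{B})$-equationally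 Noetherian if every infinite $\mathcal{L}(\mathcal{B})$-system $\mathbf{S}$ is equivalent over $\mathcal{B}$ to some finite subsystem $\mathbf{S}'\subseteq\mathbf{S}$. *)

theory Defs
  imports Main "HOL-Library.FuncSet"
begin

text \<open>
  A structure for the language with one binary relation symbol is given by a carrier set
  \<open>B\<close> and a relation \<open>r\<close> on it; it is a partial order iff
  \<^term>\<open>partial_order_on B r\<close>.
\<close>

definition nontrivial_order :: "'a set \<Rightarrow> 'a rel \<Rightarrow> bool" where
  "nontrivial_order B r \<longleftrightarrow> (\<exists>a\<in>B. \<exists>b\<in>B. (a, b) \<in> r \<and> a \<noteq> b)"

definition power_carrier :: "'i set \<Rightarrow> 'a set \<Rightarrow> ('i \<Rightarrow> 'a) set" where
  "power_carrier I B = I \<rightarrow>\<^sub>E B"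

definition power_rel :: "'i set \<Rightarrow> 'a set \<Rightarrow> 'a rel \<Rightarrow> ('i \<Rightarrow> 'a) rel" where
  "power_rel I B r =
    {(f, g). f \<in> power_carrier I B \<and> g \<in> power_carrier I B \<and> (\<forall>i\<in>I. (f i, g i) \<in> r)}"

text \<open>
  The order language has no function symbols, so after adding a constant symbol for every
  element the terms are exactly the variables and the constants, and the atomic formulas are
  the equalities and the inequalities between two such terms.
\<close>

datatype 'b trm = Var nat | Const 'b

datatype 'b equation = Eq "'b trm" "'b trm" | Le "'b trm" "'b trm"

text \<open>Terms and equations in the variables \<open>x\<^sub>1, \<dots>, x\<^sub>n\<close> with constants from \<open>B\<close>.\<close>

fun trm_over :: "nat \<Rightarrow> 'b set \<Rightarrow> 'b trm \<Rightarrow> bool" where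
  "trm_over n B (Var i) \<longleftrightarrow> i \<in> {1..n}"
| "trm_over n B (Const b) \<longleftrightarrow> b \<in> B"

fun equation_over :: "nat \<Rightarrow> 'b set \<Rightarrow> 'b equation \<Rightarrow> bool" where
  "equation_over n B (Eq s t) \<longleftrightarrow> trm_over n B s \<and> trm_over n B t"
| "equation_over n B (Le s t) \<longleftrightarrow> trm_over n B s \<and> trm_over n B t"

definition system_over :: "nat \<Rightarrow> 'b set \<Rightarrow> 'b equation set \<Rightarrow> bool" where
  "system_over n B S \<longleftrightarrow> (\<forall>e\<in>S. equation_over n B e)"

fun trm_val :: "(nat \<Rightarrow> 'b) \<Rightarrow> 'b trm \<Rightarrow> 'b" where
  "trm_val p (Var i) = p i"
| "trm_val p (Const b) = b"

fun satisfies :: "'b rel \<Rightarrow> (nat \<Rightarrow> 'b) \<Rightarrow> 'b equation \<Rightarrow> bool" where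
  "satisfies r p (Eq s t) \<longleftrightarrow> trm_val p s = trm_val p t"
| "satisfies r p (Le s t) \<longleftrightarrow> (trm_val p s, trm_val p t) \<in> r"

text \<open>Points of the \<open>n\<close>-th Cartesian power of \<open>B\<close> are extensional functions on \<open>{1..n}\<close>.\<close>

definition solutions :: "nat \<Rightarrow> 'b set \<Rightarrow> 'b rel \<Rightarrow> 'b equation set \<Rightarrow> (nat \<Rightarrow> 'b) set" where
  "solutions n B r S = {p \<in> {1..n} \<rightarrow>\<^sub>E B. \<forall>e\<in>S. satisfies r p e}"

definition equationally_noetherian :: "'b set \<Rightarrow> 'b rel \<Rightarrow> bool" where
  "equationally_noetherian B r \<longleftrightarrow>
    (\<forall>n S. system_over n B S \<and> infinite S \<longrightarrow>
      (\<exists>S'\<subseteq>S. finite S' \<and> solutions n B r S' = solutions n B r S))"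

end

theory Submission
  imports Defs
begin

text \<open>
  Fix \<open>a < b\<close> in \<open>P\<close> and let \<open>u j\<close> be \<open>b\<close> at coordinate \<open>j\<close> and \<open>a\<close> at all others. Of the
  inequalities \<open>u j \<le> x\<close>, any finitely many, say those with \<open>j \<in> J\<close>, are solved by the point
  that is \<open>b\<close> on \<open>J\<close> and \<open>a\<close> off \<open>J\<close>, but this point violates every inequality with \<open>j \<notin> J\<close>.
\<close>

theorem theorem4p1:
  fixes P :: "'a set" and r :: "'a rel" and I :: "'i set"
  assumes "partial_order_on P r"
    and "nontrivial_order P r"
    and "infinite I"
  shows "\<not> equationally_noetherian (power_carrier I P) (power_rel I P r)"
proof
  assume noeth: "equationally_noetherian (power_carrier I P) (power_rel I P r)"
  obtain a b where ab: "a \<in> P" "b \<in> P" "(a, b) \<in> r" "a \<noteq> b"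
    using assms(2) unfolding nontrivial_order_def by blast
  have refl: "(a, a) \<in> r" "(b, b) \<in> r" and not_ba: "(b, a) \<notin> r"
    using assms(1) ab unfolding partial_order_on_def preorder_on_def
    by (auto dest: refl_onD antisymD)
  \<comment> \<open>Covers both roles: \<open>v {j}\<close> is the constant \<open>u j\<close> from
    above, and \<open>v J\<close> is the solving point.\<close>
  define v where "v J = (\<lambda>i\<in>I. if i \<in> J then b else a)" for J
  define eqn where "eqn j = Le (Const (v {j})) (Var 1)" for j
  have v_carrier: "v J \<in> power_carrier I P" for J
    using ab by (simp add: v_def power_carrier_def)
  have v_le_iff: "(v {j}, v J) \<in> power_rel I P r \<longleftrightarrow> j \<in> J" if "j \<in> I" for j J
  proof -
    have "(v {j}, v J) \<in> power_rel I P r \<longleftrightarrow>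
        (\<forall>i\<in>I. (if i = j then b else a, if i \<in> J then b else a) \<in> r)"
      by (simp add: power_rel_def v_carrier) (simp add: v_def)
    \<comment> \<open>Only coordinate \<open>j\<close> matters: elsewhere the left side is
      \<open>a\<close>, which lies below both values.\<close>
    also have "\<dots> \<longleftrightarrow> j \<in> J"
      using that ab(3) refl not_ba by (auto dest: bspec[of _ _ j] split: if_splits)
    finally show ?thesis .
  qed
  \<comment> \<open>Noetherianity concerns infinite systems only, so the equations must not
    collapse.\<close>
  have "inj_on eqn I"
  proof (rule inj_onI)
    fix j k assume "j \<in> I" "k \<in> I" "eqn j = eqn k"
    then show "j = k"
      using v_le_iff[of j "{j}"] v_le_iff[of j "{k}"] by (simp add: eqn_def)
  qed
  then have "infinite (eqn ` I)"
    using assms(3) by (simp add: finite_image_iff)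
  moreover have "system_over 1 (power_carrier I P) (eqn ` I)"
    by (auto simp: system_over_def eqn_def v_carrier)
  ultimately obtain S' where "S' \<subseteq> eqn ` I" "finite S'" and
    eq: "solutions 1 (power_carrier I P) (power_rel I P r) S' =
         solutions 1 (power_carrier I P) (power_rel I P r) (eqn ` I)"
    using noeth unfolding equationally_noetherian_def by blast
  then obtain J where J: "J \<subseteq> I" "finite J" "S' = eqn ` J"
    by (meson finite_subset_image)
  have sol_iff: "(\<lambda>m\<in>{1..1}. v J) \<in> solutions 1 (power_carrier I P) (power_rel I P r) (eqn ` K)
      \<longleftrightarrow> K \<subseteq> J" if "K \<subseteq> I" for K
    using that by (auto simp: solutions_def eqn_def v_carrier v_le_iff subset_iff)
  \<comment> \<open>With \<open>K = J\<close> the point solves \<open>S'\<close>, hence the whole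
    system; \<open>K = I\<close> then gives the inclusion.\<close>
  have "I \<subseteq> J"
    using eq J sol_iff[of J] sol_iff[of I] by simp
  with J assms(3) show False
    by (simp add: finite_subset)
qed

end
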